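(* The semi-infinite five diagonal matrix $\mathbf{H}$ can be obtained from the matrix $(\mathbf{J}_{[2]}-c\mathbf{I})^2$ as follows: $$\mathbf{H}=\mathbf{T}\,(\mathbf{J}_{[2]}-c\mathbf{I})^2\,\mathbf{T}^{-1}.$$
   Context: $\mu$ is a positive Borel measure with infinite support contained in an interval $E\subseteq\mathbb{R}$ (bounded or unbounded), with all moments finite; $c\in\mathbb{R}\setminus E$ and $M,N\ge0$. $\{s_n^{M,N}\}_{n\ge0}$ are the polynomials (of degree $n$, positive leading coefficient) orthonormal with respect to $\langle f,g\rangle_S=\int_Efg\,d\mu+Mf(c)g(c)+Nf'(c)g'(c)$. $\{p_n^{[2]}\}_{n\ge0}$ are the polynomials (positive leading coefficients) orthonormal with respect to $\langle f,g\rangle_{[2]}=\int_Ef(x)g(x)(x-c)^2d\mu$. Write $\bar{\mathbf{s}}^{M,N}=[s_0^{M,N},s_1^{M,N},\dots]^\intercal$ and $\bar{\mathbf{p}}^{[2]}=[p_0^{[2]},p_1^{[2]},\dots]^\intercal$. $\mathbf{H}$ is the semi-infinite symmetric five diagonal matrix of multiplication by $(x-c)^2$ in the basis $\{s_n^{M,N}\}$: $(x-c)^2\bar{\mathbf{s}}^{M,N}=\mathbf{H}\,\bar{\mathbf{s}}^{M,N}$, with entries $\mathbf{H}_{n,k}=\langle(x-c)^2s_n^{M,N},s_k^{M,N}\rangle_S$. $\mathbf{J}_{[2]}$ is the semi-infinite symmetric (tridiagonal) Jacobi matrix with $x\,\bar{\mathbf{p}}^{[2]}=\mathbf{J}_{[2]}\bar{\mathbf{p}}^{[2]}$.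 $\mathbf{T}$ is the lower triangular matrix with positive diagonal entries such that $\bar{\mathbf{s}}^{M,N}=\mathbf{T}\,\bar{\mathbf{p}}^{[2]}$ (row $n$ of $\mathbf{T}$ has nonzero entries only in columns $n-2,n-1,n$), and $\mathbf{T}^{-1}$ is its lower triangular inverse. $\mathbf{I}$ is the identity matrix. *)

theory Defs
  imports
    "HOL-Analysis.Analysis"
    "HOL-Computational_Algebra.Polynomial"
    "HOL-Library.Groups_Big_Fun"
begin

definition measure_support :: "real measure \<Rightarrow> real set" where
  "measure_support \<mu> = {x. \<forall>U. open U \<longrightarrow> x \<in> U \<longrightarrow> emeasure \<mu> U > 0}"

definition sobolev_inner ::
    "real measure \<Rightarrow> real set \<Rightarrow> real \<Rightarrow> real \<Rightarrow> real \<Rightarrow> real poly \<Rightarrow> real poly \<Rightarrow> real" where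
  "sobolev_inner \<mu> E c M N f g =
     (LINT x:E|\<mu>. poly f x * poly g x)
     + M * poly f c * poly g c
     + N * poly (pderiv f) c * poly (pderiv g) c"

definition christoffel_inner ::
    "real measure \<Rightarrow> real set \<Rightarrow> real \<Rightarrow> real poly \<Rightarrow> real poly \<Rightarrow> real" where
  "christoffel_inner \<mu> E c f g = (LINT x:E|\<mu>. poly f x * poly g x * (x - c)\<^sup>2)"

definition orthonormal_polys ::
    "(real poly \<Rightarrow> real poly \<Rightarrow> real) \<Rightarrow> (nat \<Rightarrow> real poly) \<Rightarrow> bool" where
  "orthonormal_polys B p \<longleftrightarrow>
     (\<forall>n. degree (p n) = n \<and> lead_coeff (p n) > 0) \<and>
     (\<forall>m n. B (p m) (p n) = (if m = n then 1 else 0))"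

type_synonym smat = "nat \<Rightarrow> nat \<Rightarrow> real"

definition smat_one :: smat where
  "smat_one = (\<lambda>i j. if i = j then 1 else 0)"

(* Sum_any is the finite sum over the indices with nonzero summand (and 0 if there are
   infinitely many of them), so the two operations below have their intended meaning when
   the left factor has only finitely many nonzero entries in each row. This holds for all
   banded and all lower triangular matrices, and products of such matrices. *)

definition smat_mult :: "smat \<Rightarrow> smat \<Rightarrow> smat" (infixl "\<odot>" 70) where
  "A \<odot> B = (\<lambda>i j. Sum_any (\<lambda>k. A i k * B k j))"

definition smat_poly :: "smat \<Rightarrow> (nat \<Rightarrow> real poly) \<Rightarrow> nat \<Rightarrow> real poly" where
  "smat_poly A p = (\<lambda>n. Sum_any (\<lambda>k. smult (A n k) (p k)))"

definition smat_shift :: "smat \<Rightarrow> real \<Rightarrow> smat" where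
  "smat_shift A c = (\<lambda>i j. A i j - c * smat_one i j)"

definition lower_triangular :: "smat \<Rightarrow> bool" where
  "lower_triangular A \<longleftrightarrow> (\<forall>i j. i < j \<longrightarrow> A i j = 0)"

definition jacobi_matrix :: "(nat \<Rightarrow> real poly) \<Rightarrow> smat \<Rightarrow> bool" where
  "jacobi_matrix p J \<longleftrightarrow>
     (\<forall>i j. J i j = J j i) \<and>
     (\<forall>i j. i + 1 < j \<or> j + 1 < i \<longrightarrow> J i j = 0) \<and>
     (\<lambda>n. [:0, 1:] * p n) = smat_poly J p"

definition connection_matrix :: "(nat \<Rightarrow> real poly) \<Rightarrow> (nat \<Rightarrow> real poly) \<Rightarrow> smat \<Rightarrow> bool" where
  "connection_matrix s p T \<longleftrightarrow>
     lower_triangular T \<and> (\<forall>n. T n n > 0) \<and> s = smat_poly T p"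

definition lower_triangular_inverse :: "smat \<Rightarrow> smat \<Rightarrow> bool" where
  "lower_triangular_inverse A B \<longleftrightarrow>
     lower_triangular B \<and> A \<odot> B = smat_one \<and> B \<odot> A = smat_one"

definition sobolev_mult_matrix ::
    "real measure \<Rightarrow> real set \<Rightarrow> real \<Rightarrow> real \<Rightarrow> real \<Rightarrow> (nat \<Rightarrow> real poly) \<Rightarrow> smat" where
  "sobolev_mult_matrix \<mu> E c M N s =
     (\<lambda>n k. sobolev_inner \<mu> E c M N ([:- c, 1:]\<^sup>2 * s n) (s k))"

end

(* Both sides represent multiplication by (x - c)^2 in the basis s: the right-hand side because
   T and its inverse change between the bases s and p, the left-hand side because s is orthonormal.
   Since infinite sums appear only along finitely supported rows, everything reduces to finite
   sums and the linearity of the inner product. *)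
theory Submission
  imports Defs
begin

text \<open>The condition that makes each \<open>Sum_any\<close> over a row a genuine finite sum
  instead of its default 0. It covers banded and lower triangular matrices alike and is stable under
  products.\<close>

definition row_finite :: "smat \<Rightarrow> bool" where
  "row_finite A \<longleftrightarrow> (\<forall>i. finite {k. A i k \<noteq> 0})"

lemma row_finiteI_bound:
  assumes "\<And>i k. k > b i \<Longrightarrow> A i k = 0"
  shows "row_finite A"
  unfolding row_finite_def
proof
  fix i
  have "{k. A i k \<noteq> 0} \<subseteq> {..b i}"
    using assms by (force simp: not_less[symmetric])
  then show "finite {k. A i k \<noteq> 0}"
    by (rule finite_subset) simp
qed

lemma smult_sum_right: "smult c (sum f S) = (\<Sum>i\<in>S. smult c (f i))"
  by (induction S rule: infinite_finite_induct) (simp_all add: smult_add_right)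

lemma row_finite_lower_triangular: "lower_triangular A \<Longrightarrow> row_finite A"
  by (rule row_finiteI_bound[where b = "\<lambda>i. i"]) (simp add: lower_triangular_def)

lemma smat_mult_eq_sum:
  assumes "row_finite A"
  shows "(A \<odot> B) i j = (\<Sum>k | A i k \<noteq> 0. A i k * B k j)"
  unfolding smat_mult_def
  using assms by (intro Sum_any.expand_superset) (auto simp: row_finite_def)

text \<open>Enlarging the index set only adds zero terms; the free choice of \<open>S\<close> lets
  several expansions share one index set.\<close>

lemma smat_poly_eq_sum:
  assumes "finite S" and "{k. A n k \<noteq> 0} \<subseteq> S"
  shows "smat_poly A p n = (\<Sum>k\<in>S. smult (A n k) (p k))"
  unfolding smat_poly_def
  using assms by (intro Sum_any.expand_superset) auto

text \<open>If column \<open>j\<close> vanishes in every row \<open>k\<close> that meets the support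
  of row \<open>i\<close> of \<open>A\<close>, all summands of the entry are 0. For row-finite
  \<open>B\<close> the bound is a finite union of finite sets.\<close>

lemma smat_mult_support:
  assumes "row_finite A"
  shows "{j. (A \<odot> B) i j \<noteq> 0} \<subseteq> (\<Union>k\<in>{k. A i k \<noteq> 0}. {j. B k j \<noteq> 0})"
  by (force simp: smat_mult_eq_sum[OF assms] intro: sum.neutral)

lemma row_finite_smat_mult:
  assumes "row_finite A" and "row_finite B"
  shows "row_finite (A \<odot> B)"
  unfolding row_finite_def
  using smat_mult_support[OF assms(1)] assms
  by (auto simp: row_finite_def intro!: finite_subset[OF smat_mult_support[OF assms(1)]])

text \<open>Finite sums may be interchanged. This turns matrix products into composed actions on
  polynomial sequences.\<close>

lemma smat_poly_smat_mult:
  assumes "row_finite A" and "row_finite B"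
  shows "smat_poly (A \<odot> B) p = smat_poly A (smat_poly B p)"
proof
  fix n
  define S where "S = {k. A n k \<noteq> 0}"
  \<comment> \<open>\<open>R\<close> does not depend on \<open>k\<close>: it contains the support of
    row \<open>n\<close> of the product and of every row of \<open>B\<close> involved, so the two
    sums can be swapped.\<close>
  define R where "R = (\<Union>k\<in>S. {j. B k j \<noteq> 0})"
  have S: "finite S" and R: "finite R"
    using assms by (auto simp: S_def R_def row_finite_def)
  have "smat_poly (A \<odot> B) p n = (\<Sum>j\<in>R. smult ((A \<odot> B) n j) (p j))"
    using R smat_mult_support[OF assms(1)] by (intro smat_poly_eq_sum) (auto simp: R_def S_def)
  also have "\<dots> = (\<Sum>j\<in>R. \<Sum>k\<in>S. smult (A n k * B k j) (p j))"
    by (simp add: smat_mult_eq_sum[OF assms(1)] S_def smult_sum)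
  also have "\<dots> = (\<Sum>k\<in>S. \<Sum>j\<in>R. smult (A n k * B k j) (p j))"
    by (rule sum.swap)
  also have "\<dots> = (\<Sum>k\<in>S. smult (A n k) (\<Sum>j\<in>R. smult (B k j) (p j)))"
    by (simp add: smult_sum_right)
  also have "\<dots> = (\<Sum>k\<in>S. smult (A n k) (smat_poly B p k))"
    using R by (intro sum.cong refl arg_cong2[where f = smult] smat_poly_eq_sum[symmetric])
      (auto simp: R_def)
  also have "\<dots> = smat_poly A (smat_poly B p) n"
    using S by (intro smat_poly_eq_sum[symmetric]) (auto simp: S_def)
  finally show "smat_poly (A \<odot> B) p n = smat_poly A (smat_poly B p) n" .
qed

lemma smat_poly_mult_left:
  assumes "row_finite A"
  shows "smat_poly A (\<lambda>n. q * p n) = (\<lambda>n. q * smat_poly A p n)"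
proof
  fix n
  have S: "finite {k. A n k \<noteq> 0}"
    using assms by (simp add: row_finite_def)
  show "smat_poly A (\<lambda>n. q * p n) n = q * smat_poly A p n"
    by (simp add: smat_poly_eq_sum[where A = A and n = n, OF S subset_refl] sum_distrib_left)
qed

lemma smat_poly_one: "smat_poly smat_one p = p"
proof
  fix n
  have "smat_poly smat_one p n = (\<Sum>k\<in>{n}. smult (smat_one n k) (p k))"
    by (rule smat_poly_eq_sum) (auto simp: smat_one_def)
  then show "smat_poly smat_one p n = p n"
    by (simp add: smat_one_def)
qed

lemma row_finite_smat_shift:
  assumes "row_finite A"
  shows "row_finite (smat_shift A c)"
  unfolding row_finite_def
proof
  fix i
  have "{k. smat_shift A c i k \<noteq> 0} \<subseteq> insert i {k. A i k \<noteq> 0}"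
    by (auto simp: smat_shift_def smat_one_def)
  then show "finite {k. smat_shift A c i k \<noteq> 0}"
    using assms by (auto simp: row_finite_def intro: finite_subset)
qed

lemma smat_poly_shift:
  assumes "row_finite A"
  shows "smat_poly (smat_shift A c) p n = smat_poly A p n - smult c (p n)"
proof -
  \<comment> \<open>The index \<open>n\<close> is added because the shift can create a diagonal
    entry where \<open>A n n\<close> is 0.\<close>
  define S where "S = insert n {k. A n k \<noteq> 0}"
  have S: "finite S"
    using assms by (simp add: S_def row_finite_def)
  have "smat_poly (smat_shift A c) p n = (\<Sum>k\<in>S. smult (smat_shift A c n k) (p k))"
    using S by (rule smat_poly_eq_sum) (auto simp: S_def smat_shift_def smat_one_def)
  also have "\<dots> = (\<Sum>k\<in>S. smult (A n k) (p k)) - smult c (\<Sum>k\<in>S. smult (smat_one n k) (p k))"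
    by (simp add: smat_shift_def smult_diff_left sum_subtractf smult_sum_right)
  also have "(\<Sum>k\<in>S. smult (A n k) (p k)) = smat_poly A p n"
    using S by (rule smat_poly_eq_sum[symmetric]) (auto simp: S_def)
  also have "(\<Sum>k\<in>S. smult (smat_one n k) (p k)) = smat_poly smat_one p n"
    using S by (rule smat_poly_eq_sum[symmetric]) (auto simp: S_def smat_one_def)
  finally show ?thesis
    by (simp add: smat_poly_one)
qed

lemma row_finite_jacobi:
  assumes "jacobi_matrix p J"
  shows "row_finite J"
  \<comment> \<open>By tridiagonality, row \<open>i\<close> ends at column \<open>i + 1\<close> at
    the latest.\<close>
  by (rule row_finiteI_bound[where b = Suc]) (use assms in \<open>simp add: jacobi_matrix_def\<close>)

lemma smat_poly_jacobi_shift: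
  assumes "jacobi_matrix p J"
  shows "smat_poly (smat_shift J c) p = (\<lambda>n. [:- c, 1:] * p n)"
proof
  fix n
  have "smat_poly J p n = [:0, 1:] * p n"
    using assms by (simp add: jacobi_matrix_def fun_eq_iff)
  then show "smat_poly (smat_shift J c) p n = [:- c, 1:] * p n"
    by (simp add: smat_poly_shift[OF row_finite_jacobi[OF assms]])
qed

text \<open>One application produces the factor \<open>x - c\<close>; it is the same for all
  indices, so it passes through the second application.\<close>

lemma smat_poly_jacobi_shift_square:
  assumes "jacobi_matrix p J"
  shows "smat_poly (smat_shift J c \<odot> smat_shift J c) p = (\<lambda>n. [:- c, 1:]\<^sup>2 * p n)"
proof -
  have "row_finite (smat_shift J c)"
    using assms by (intro row_finite_smat_shift row_finite_jacobi)
  then show ?thesis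
    \<comment> \<open>The deleted rules would expand the product with \<open>[:- c, 1:]\<close>,
      which has to stay intact as a common factor.\<close>
    by (simp add: smat_poly_smat_mult smat_poly_jacobi_shift[OF assms] smat_poly_mult_left
        power2_eq_square mult.assoc del: mult_pCons_left mult_pCons_right)
qed

text \<open>A polynomial is a finite combination of the powers whose integrability is assumed. This
  justifies linearity of the integral below.\<close>

lemma set_integrable_poly:
  fixes f :: "real poly"
  assumes "\<And>n::nat. set_integrable \<mu> E (\<lambda>x. x ^ n)"
  shows "set_integrable \<mu> E (poly f)"
proof -
  have "integrable \<mu> (\<lambda>x. \<Sum>i\<le>degree f. coeff f i * (indicator E x *\<^sub>R x ^ i))"
    using assms unfolding set_integrable_def
    by (intro Bochner_Integration.integrable_sum integrable_mult_right) auto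
  also have "(\<lambda>x. \<Sum>i\<le>degree f. coeff f i * (indicator E x *\<^sub>R x ^ i))
      = (\<lambda>x. indicator E x *\<^sub>R poly f x)"
    by (auto simp: poly_altdef indicator_def)
  finally show ?thesis
    by (simp add: set_integrable_def)
qed

lemma sobolev_inner_sum_left:
  assumes "\<And>n::nat. set_integrable \<mu> E (\<lambda>x. x ^ n)" and "finite S"
  shows "sobolev_inner \<mu> E c M N (\<Sum>k\<in>S. smult (a k) (f k)) g
    = (\<Sum>k\<in>S. a k * sobolev_inner \<mu> E c M N (f k) g)"
proof -
  \<comment> \<open>The integrand is itself a polynomial, namely
    \<open>smult (a k) (f k * g)\<close>.\<close>
  have int: "set_integrable \<mu> E (\<lambda>x. a k * (poly (f k) x * poly g x))" for k
    using set_integrable_poly[OF assms(1), of "smult (a k) (f k * g)"]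
    by (simp add: poly_mult[abs_def] poly_smult[abs_def])
  have "(LINT x:E|\<mu>. poly (\<Sum>k\<in>S. smult (a k) (f k)) x * poly g x)
      = (LINT x:E|\<mu>. \<Sum>k\<in>S. a k * (poly (f k) x * poly g x))"
    by (simp add: poly_sum sum_distrib_right mult.assoc)
  also have "\<dots> = (\<Sum>k\<in>S. a k * (LINT x:E|\<mu>. poly (f k) x * poly g x))"
    using int by (simp add: set_lebesgue_integral_def set_integrable_def sum_distrib_left mult.left_commute)
  finally show ?thesis
    \<comment> \<open>Additivity of the first derivative is taken as the order 1 case of the rule
      for iterated derivatives.\<close>
    by (simp add: sobolev_inner_def poly_sum higher_pderiv_sum[of 1, simplified] pderiv_smult sum_distrib_left
        sum_distrib_right sum.distrib algebra_simps)
qed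

text \<open>Pairing with \<open>s k\<close> extracts the Fourier coefficient, so a row-finite matrix
  is determined by its action on an orthonormal sequence.\<close>

lemma sobolev_inner_smat_poly:
  assumes "\<And>n::nat. set_integrable \<mu> E (\<lambda>x. x ^ n)"
    and "orthonormal_polys (sobolev_inner \<mu> E c M N) s"
    and "row_finite A"
  shows "sobolev_inner \<mu> E c M N (smat_poly A s n) (s k) = A n k"
proof -
  have S: "finite {j. A n j \<noteq> 0}"
    using assms(3) by (simp add: row_finite_def)
  have "sobolev_inner \<mu> E c M N (smat_poly A s n) (s k)
      = (\<Sum>j | A n j \<noteq> 0. A n j * (if j = k then 1 else 0))"
    using assms(2)
    by (simp add: smat_poly_eq_sum[where A = A and n = n, OF S subset_refl] sobolev_inner_sum_left[OF assms(1) S]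
        orthonormal_polys_def)
  \<comment> \<open>If \<open>k\<close> lies outside the support, the sum is 0, which is then also
    the value of \<open>A n k\<close>.\<close>
  also have "\<dots> = A n k"
    using S by (simp add: if_distrib[of "(*) _"] cong: if_cong)
  finally show ?thesis .
qed

theorem proposition2:
  fixes \<mu> :: "real measure" and E :: "real set" and c M N :: real
    and s p :: "nat \<Rightarrow> real poly" and H J T Tinv :: smat
  assumes "sets \<mu> = sets borel"
    and "is_interval E"
    and "measure_support \<mu> \<subseteq> E"
    and "infinite (measure_support \<mu>)"
    and "\<And>n::nat. set_integrable \<mu> E (\<lambda>x. x ^ n)"
    and "c \<notin> E"
    and "M \<ge> 0" and "N \<ge> 0"
    and "orthonormal_polys (sobolev_inner \<mu> E c M N) s"
    and "orthonormal_polys (christoffel_inner \<mu> E c) p"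
    and "H = sobolev_mult_matrix \<mu> E c M N s"
    and "jacobi_matrix p J"
    and "connection_matrix s p T"
    and "lower_triangular_inverse T Tinv"
  shows "H = T \<odot> (smat_shift J c \<odot> smat_shift J c) \<odot> Tinv"
proof -
  let ?A = "smat_shift J c \<odot> smat_shift J c"
  have T: "row_finite T" and s: "s = smat_poly T p"
    using \<open>connection_matrix s p T\<close>
    by (simp_all add: connection_matrix_def row_finite_lower_triangular)
  have Tinv: "row_finite Tinv" and inv: "Tinv \<odot> T = smat_one"
    using \<open>lower_triangular_inverse T Tinv\<close>
    by (simp_all add: lower_triangular_inverse_def row_finite_lower_triangular)
  have A: "row_finite ?A"
    using \<open>jacobi_matrix p J\<close>
    by (intro row_finite_smat_mult row_finite_smat_shift row_finite_jacobi)
  have "smat_poly Tinv s = p"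
    by (simp add: s smat_poly_smat_mult[OF Tinv T, symmetric] inv smat_poly_one)
  \<comment> \<open>The rightmost factor acts first: \<open>Tinv\<close> carries \<open>s\<close> to
    \<open>p\<close>, where the action of \<open>?A\<close> is known.\<close>
  then have "smat_poly (T \<odot> ?A \<odot> Tinv) s = smat_poly T (smat_poly ?A p)"
    by (simp add: smat_poly_smat_mult row_finite_smat_mult T A Tinv)
  \<comment> \<open>The factor \<open>(x - c)^2\<close> passes through \<open>T\<close>, which
    carries \<open>p\<close> back to \<open>s\<close>.\<close>
  also have "\<dots> = (\<lambda>n. [:- c, 1:]\<^sup>2 * s n)"
    by (simp add: smat_poly_jacobi_shift_square[OF \<open>jacobi_matrix p J\<close>] smat_poly_mult_left T s)
  finally have mult: "[:- c, 1:]\<^sup>2 * s n = smat_poly (T \<odot> ?A \<odot> Tinv) s n" for n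
    by simp
  have "row_finite (T \<odot> ?A \<odot> Tinv)"
    by (intro row_finite_smat_mult T A Tinv)
  \<comment> \<open>Replacing \<open>(x - c)^2 s_n\<close> by this expansion inside the entries of
    \<open>H\<close> leaves exactly the coefficients of the matrix product.\<close>
  with assms(5) \<open>orthonormal_polys (sobolev_inner \<mu> E c M N) s\<close> show ?thesis
    by (intro ext) (simp add: \<open>H = _\<close> sobolev_mult_matrix_def mult sobolev_inner_smat_poly)
qed

end
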